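(* For each instant $t$ let $A(t)\in\mathbb R^{p\times m}$ and $b=b(t)\in\mathbb R^p$ be the balance-plus-normalisation matrix and right-hand side defined in the context, $M(t)=\{x\in\mathbb R^m: A(t)x=b(t)\}$, and let $P(t)\in\mathbb R^m$ be an operator vector. (i) For $\delta\in\ker A(t)$ the macro forecast $A(t)P(t)$ is invariant under $P(t)\mapsto P(t)+\delta$. (ii) The orthogonal projection onto $M(t)$, $\Pi_{M(t)}(x)=x-A^{\top}(AA^{\top})^{-1}(Ax-b)$ with $A=A(t)$, satisfies $A(t)\,\Pi_{M(t)}(x)=b$ for every $x\in\mathbb R^m$. (iii) If $\delta\in\ker A(t-1)$ and $\Delta A=A(t)-A(t-1)$, then $A(t)\delta=\Delta A\,\delta$ and $\|A(t)\delta\|\le\|\Delta A\|\,\|\delta\|$ (operator norm and Euclidean norms). In particular this balance violation vanishes when $A$ is time-invariant, i.e. $A(t)=A(t-1)$.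
   Context: Fix an integer $n\ge 1$. For an instant $t$ the data are: counts $N_1^{(i)}(t)>0$ for $i=1,\dots,n$ (active clusters) and $N_2^{(i)}(t)>0$ for $i=0,\dots,n$ (passive clusters; index $0$ is the reserve); nonnegative counts $N_1^{(i)}(t+1)$, $N_2^{(i)}(t+1)$ at time $t+1$; and an exogenous inflow $\Delta N_2^{(0)}(t)\ge 0$. Put $N_{\mathrm{eff}}^{(0)}=\Delta N_2^{(0)}(t)+N_2^{(0)}(t)$. The unknown vector $x\in\mathbb R^m$, $m=2n^2+5n+2$, has the components $P_{11}^{(i,j)}$ ($1\le i\le n$, $j\in\{1,\dots,n+1\}\setminus\{i\}$), $P_{12}^{(i)}$ ($1\le i\le n$), $P_{21}^{(i,j)}$ ($0\le i\le n$, $1\le j\le n+1$), $P^{*(i)}$ ($0\le i\le n$), $P^{**(i)}$ ($1\le i\le n$); the destination index $j=n+1$ means departure from the system. With $p=4n+2$, the matrix $A(t)\in\mathbb R^{p\times m}$ and vector $b(t)\in\mathbb R^p$ are defined by declaring $A(t)x=b(t)$ to be the following system of $p$ linear equations. Balance equations ($2n+1$ of them): for $i=1,\dots,n$, $$\sum_{j=1}^n N_2^{(j)}(t)P_{21}^{(j,i)}+N_{\mathrm{eff}}^{(0)}P_{21}^{(0,i)}+\sum_{j\le n,\,j\ne i}N_1^{(j)}(t)P_{11}^{(j,i)}-N_1^{(i)}(t)\Bigl[P_{12}^{(i)}+\sum_{j\le n+1,\,j\neq i}P_{11}^{(i,j)}\Bigr]=N_1^{(i)}(t+1)-N_1^{(i)}(t);$$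 $$-N_{\mathrm{eff}}^{(0)}\sum_{j=1}^{n+1}P_{21}^{(0,j)}=N_2^{(0)}(t+1)-N_2^{(0)}(t)-\Delta N_2^{(0)}(t);$$ and for $i=1,\dots,n$, $\;N_1^{(i)}(t)P_{12}^{(i)}-N_2^{(i)}(t)\sum_{j=1}^{n+1}P_{21}^{(i,j)}=N_2^{(i)}(t+1)-N_2^{(i)}(t)$. Normalisation equations ($2n+1$ of them): $P_{12}^{(i)}+\sum_{j\le n+1,\,j\ne i}P_{11}^{(i,j)}+P^{**(i)}=1$ for $i=1,\dots,n$, and $\sum_{j=1}^{n+1}P_{21}^{(i,j)}+P^{*(i)}=1$ for $i=0,\dots,n$. *)

theory Defs
  imports "HOL-Analysis.Analysis"
begin

section \<open>Cluster data\<close>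

text \<open>
  The clusters \<open>1, \<dots>, n\<close> are the elements of a finite type \<open>'n\<close>, so \<open>n = CARD('n) \<ge> 1\<close>.  The two
  extended index ranges are both rendered by \<open>'n option\<close>, with a different meaning of the
  extra element: a passive index in \<open>{0, \<dots>, n}\<close> uses it for the reserve \<open>0\<close>, and a
  destination index in \<open>{1, \<dots>, n + 1}\<close> uses it for departure from the system \<open>n + 1\<close>.
\<close>

abbreviation (input) reserve :: "'n option" where "reserve \<equiv> None"

text \<open>
  \<open>N1\<close>: active counts, \<open>N2\<close>: passive counts, \<open>dN20\<close>: exogenous inflow into the reserve.
\<close>

record 'n cluster_data =
  N1 :: "int \<Rightarrow> 'n \<Rightarrow> real"
  N2 :: "int \<Rightarrow> 'n option \<Rightarrow> real"
  dN20 :: "int \<Rightarrow> real"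

definition admissible :: "'n cluster_data \<Rightarrow> int \<Rightarrow> bool" where
  "admissible S t \<longleftrightarrow>
     (\<forall>i. N1 S t i > 0) \<and> (\<forall>i. N2 S t i > 0) \<and>
     (\<forall>i. N1 S (t + 1) i \<ge> 0) \<and> (\<forall>i. N2 S (t + 1) i \<ge> 0) \<and>
     dN20 S t \<ge> 0"

definition N_eff :: "'n cluster_data \<Rightarrow> int \<Rightarrow> real" where
  "N_eff S t = dN20 S t + N2 S t reserve"


section \<open>Coordinates of operator vectors\<close>

datatype 'n label =
    P11 'n "'n option"
  | P12 'n
  | P21 "'n option" "'n option"
  | P_star "'n option"
  | P_sstar 'n

text \<open>The components \<open>P11 i j\<close> exist only for destinations \<open>j\<close> different from \<open>i\<close>.\<close>

typedef 'n var = "{l :: 'n label. \<forall>i. l \<noteq> P11 i (Some i)}"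
  by (rule exI[of _ "P12 undefined"]) simp

lemma UNIV_label:
  "(UNIV :: 'n label set) =
     case_prod P11 ` UNIV \<union> range P12 \<union> case_prod P21 ` UNIV \<union> range P_star \<union> range P_sstar"
proof -
  have "l \<in> case_prod P11 ` UNIV \<union> range P12 \<union> case_prod P21 ` UNIV \<union> range P_star \<union> range P_sstar"
    for l :: "'n label"
    by (cases l) (auto simp: image_iff)
  then show ?thesis by blast
qed

instance label :: (finite) finite
  by standard (simp add: UNIV_label)

instance var :: (finite) finite
  by standard (simp add: type_definition.univ[OF type_definition_var])

lemma card_var: "CARD('n::finite var) = 2 * CARD('n)\<^sup>2 + 5 * CARD('n) + 2"
proof -
  let ?D = "UNIV - range (\<lambda>i::'n. (i, Some i))"
  let ?R = "case_prod P11 ` ?D \<union> (range P12 \<union> (case_prod P21 ` UNIV \<union> (range P_star \<union> range P_sstar)))"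
  have "l \<in> {l :: 'n label. \<forall>i. l \<noteq> P11 i (Some i)} \<longleftrightarrow> l \<in> ?R" for l
  proof (cases l)
    case (P11 i j)
    have "P11 i j \<in> case_prod P11 ` ?D \<longleftrightarrow> (i, j) \<in> ?D" by force
    with P11 show ?thesis by auto
  qed auto
  then have eq: "{l :: 'n label. \<forall>i. l \<noteq> P11 i (Some i)} = ?R" by blast
  have "card ?D = CARD('n) * Suc (CARD('n)) - CARD('n)"
    by (subst card_Diff_subset) (auto simp: card_image inj_on_def card_UNIV_option card_cartesian_product
        simp flip: UNIV_Times_UNIV)
  then have D: "card ?D = CARD('n) * CARD('n)" by simp
  have inj: "inj_on (case_prod P11) ?D" "inj (P12 :: 'n \<Rightarrow> _)"
    "inj (case_prod P21 :: 'n option \<times> 'n option \<Rightarrow> _)"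
    "inj (P_star :: 'n option \<Rightarrow> _)" "inj (P_sstar :: 'n \<Rightarrow> _)"
    by (auto simp: inj_on_def)
  have "card ?R = card (case_prod P11 ` ?D) + (card (range (P12 :: 'n \<Rightarrow> _)) +
      (card (range (case_prod P21 :: 'n option \<times> 'n option \<Rightarrow> _)) +
      (card (range (P_star :: 'n option \<Rightarrow> _)) + card (range (P_sstar :: 'n \<Rightarrow> _)))))"
    by (subst card_Un_disjoint, simp, simp, force)+ (rule refl)
  also have "\<dots> = 2 * CARD('n)\<^sup>2 + 5 * CARD('n) + 2"
    by (simp add: card_image inj D card_UNIV_option power2_eq_square)
  finally show ?thesis
    by (simp add: type_definition.card[OF type_definition_var] eq)
qed

definition component :: "real ^ 'n::finite var \<Rightarrow> 'n label \<Rightarrow> real" where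
  "component x l = x $ Abs_var l"


section \<open>Balance and normalisation equations\<close>

datatype 'n eqn =
    Bal_active 'n
  | Bal_reserve
  | Bal_passive 'n
  | Norm_active 'n
  | Norm_passive "'n option"

lemma UNIV_eqn:
  "(UNIV :: 'n eqn set) =
     range Bal_active \<union> ({Bal_reserve} \<union> (range Bal_passive \<union> (range Norm_active \<union> range Norm_passive)))"
proof -
  have "e \<in> range Bal_active \<union> ({Bal_reserve} \<union> (range Bal_passive \<union> (range Norm_active \<union> range Norm_passive)))"
    for e :: "'n eqn"
    by (cases e) auto
  then show ?thesis by blast
qed

instance eqn :: (finite) finite
  by standard (simp add: UNIV_eqn)

lemma card_eqn: "CARD('n::finite eqn) = 4 * CARD('n) + 2"
proof -
  have inj: "inj (Bal_active :: 'n \<Rightarrow> _)" "inj (Bal_passive :: 'n \<Rightarrow> _)"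
    "inj (Norm_active :: 'n \<Rightarrow> _)" "inj (Norm_passive :: 'n option \<Rightarrow> _)"
    by (auto simp: inj_on_def)
  have "CARD('n eqn) = CARD('n) + (1 + (CARD('n) + (CARD('n) + CARD('n option))))"
    unfolding UNIV_eqn
    by (subst card_Un_disjoint, simp, simp, blast)+ (simp add: card_image inj)
  then show ?thesis by (simp add: card_UNIV_option)
qed

fun eqn_lhs :: "'n::finite cluster_data \<Rightarrow> int \<Rightarrow> real ^ 'n var \<Rightarrow> 'n eqn \<Rightarrow> real" where
  "eqn_lhs S t x (Bal_active i) =
     (\<Sum>j\<in>UNIV. N2 S t (Some j) * component x (P21 (Some j) (Some i)))
     + N_eff S t * component x (P21 reserve (Some i))
     + (\<Sum>j\<in>UNIV - {i}. N1 S t j * component x (P11 j (Some i)))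
     - N1 S t i * (component x (P12 i) + (\<Sum>j\<in>UNIV - {Some i}. component x (P11 i j)))"
| "eqn_lhs S t x Bal_reserve = - N_eff S t * (\<Sum>j\<in>UNIV. component x (P21 reserve j))"
| "eqn_lhs S t x (Bal_passive i) =
     N1 S t i * component x (P12 i)
     - N2 S t (Some i) * (\<Sum>j\<in>UNIV. component x (P21 (Some i) j))"
| "eqn_lhs S t x (Norm_active i) =
     component x (P12 i) + (\<Sum>j\<in>UNIV - {Some i}. component x (P11 i j)) + component x (P_sstar i)"
| "eqn_lhs S t x (Norm_passive i) =
     (\<Sum>j\<in>UNIV. component x (P21 i j)) + component x (P_star i)"

fun eqn_rhs :: "'n cluster_data \<Rightarrow> int \<Rightarrow> 'n eqn \<Rightarrow> real" where
  "eqn_rhs S t (Bal_active i) = N1 S (t + 1) i - N1 S t i"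
| "eqn_rhs S t Bal_reserve = N2 S (t + 1) reserve - N2 S t reserve - dN20 S t"
| "eqn_rhs S t (Bal_passive i) = N2 S (t + 1) (Some i) - N2 S t (Some i)"
| "eqn_rhs S t (Norm_active i) = 1"
| "eqn_rhs S t (Norm_passive i) = 1"

definition A_mat :: "'n::finite cluster_data \<Rightarrow> int \<Rightarrow> real ^ 'n var ^ 'n eqn" where
  "A_mat S t = matrix (\<lambda>x. \<chi> e. eqn_lhs S t x e)"

definition b_vec :: "'n::finite cluster_data \<Rightarrow> int \<Rightarrow> real ^ 'n eqn" where
  "b_vec S t = (\<chi> e. eqn_rhs S t e)"

lemma linear_eqn_lhs: "linear (\<lambda>x :: real ^ 'n::finite var. \<chi> e. eqn_lhs S t x e)"
proof (rule linearI)
  fix x y :: "real ^ 'n var" and c :: real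
  have "eqn_lhs S t (x + y) e = eqn_lhs S t x e + eqn_lhs S t y e" for e
    by (cases e) (simp_all add: component_def sum.distrib algebra_simps)
  then show "(\<chi> e. eqn_lhs S t (x + y) e) = (\<chi> e. eqn_lhs S t x e) + (\<chi> e. eqn_lhs S t y e)"
    by (simp add: vec_eq_iff)
  have "eqn_lhs S t (c *\<^sub>R x) e = c * eqn_lhs S t x e" for e
    by (cases e) (simp_all add: component_def sum_distrib_left algebra_simps)
  then show "(\<chi> e. eqn_lhs S t (c *\<^sub>R x) e) = c *\<^sub>R (\<chi> e. eqn_lhs S t x e)"
    by (simp add: vec_eq_iff)
qed

lemma A_mat_mult_nth: "(A_mat S t *v x) $ e = eqn_lhs S t x e"
  unfolding A_mat_def by (simp add: fun_cong[OF matrix_vector_mul(2)[OF linear_eqn_lhs]])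

lemma A_mat_eq_b_vec_iff: "A_mat S t *v x = b_vec S t \<longleftrightarrow> (\<forall>e. eqn_lhs S t x e = eqn_rhs S t e)"
  by (simp add: vec_eq_iff A_mat_mult_nth b_vec_def)


section \<open>Kernel, solution set and projection\<close>

definition mat_ker :: "real ^ 'm ^ 'p \<Rightarrow> (real ^ 'm) set" where
  "mat_ker A = {x. A *v x = 0}"

definition solution_set :: "'n::finite cluster_data \<Rightarrow> int \<Rightarrow> (real ^ 'n var) set" where
  "solution_set S t = {x. A_mat S t *v x = b_vec S t}"

definition proj :: "'n::finite cluster_data \<Rightarrow> int \<Rightarrow> real ^ 'n var \<Rightarrow> real ^ 'n var" where
  "proj S t x =
     (let A = A_mat S t
      in x - transpose A *v (matrix_inv (A ** transpose A) *v (A *v x - b_vec S t)))"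

end

theory Submission
  imports Defs
begin

text \<open>The substance is that the projection formula makes sense, i.e. that
  \<open>A ** transpose A\<close> is invertible. This needs full row rank, which
  \<open>surj_A_mat\<close> derives from positivity of the counts: departure probabilities absorb
  any balance right-hand side, and the slacks then absorb any normalisation right-hand side. The
  correction subtracted from x lies in the row space of A, the orthogonal complement of the kernel,
  so the formula gives the nearest solution. The kernel claims are linearity, together with
  A(t-1)\<delta> = 0 and the operator norm bound.\<close>

lemma invertible_mult_transpose:
  fixes A :: "real ^ 'm ^ 'p"
  assumes "surj ((*v) A)"
  shows "invertible (A ** transpose A)"
proof -
  have "y = 0" if "(A ** transpose A) *v y = 0" for y
  proof -
    \<comment> \<open>This Gram identity shows that the kernel of A A^T is contained in that of
      A^T.\<close>
    have "(transpose A *v y) \<bullet> (transpose A *v y) = y \<bullet> ((A ** transpose A) *v y)"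
      by (simp add: dot_lmul_matrix flip: matrix_vector_mul_assoc)
    with that have "transpose A *v y = 0" by simp
    then have "y \<bullet> (A *v x) = 0" for x
      by (simp flip: dot_lmul_matrix)
    \<comment> \<open>By surjectivity y is itself a value of A, so y is orthogonal to
      itself.\<close>
    moreover obtain x where "y = A *v x" using assms by blast
    ultimately show "y = 0" by (metis inner_eq_zero_iff)
  qed
  then show ?thesis
    by (simp add: invertible_left_inverse matrix_left_invertible_ker)
qed

text \<open>The residual x - q is A^T applied to a vector, while y - q lies in the kernel of A for
  every solution y. Hence the two are orthogonal, and Pythagoras makes q the nearest
  solution.\<close>

lemma
  fixes A :: "real ^ 'm ^ 'p" and b :: "real ^ 'p" and x :: "real ^ 'm"
  assumes inv: "invertible (A ** transpose A)"
  defines "q \<equiv> x - transpose A *v (matrix_inv (A ** transpose A) *v (A *v x - b))"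
  shows affine_projection_solves: "A *v q = b"
    and affine_projection_orthogonal: "A *v y = b \<Longrightarrow> orthogonal (x - q) (y - q)"
    and affine_projection_closest_point: "q = closest_point {y. A *v y = b} x"
proof -
  let ?w = "matrix_inv (A ** transpose A) *v (A *v x - b)"
  have "(A ** transpose A) ** matrix_inv (A ** transpose A) = mat 1"
    \<comment> \<open>\<open>matrix_inv\<close> is a Hilbert choice, so invertibility is what makes
      it an actual inverse.\<close>
    using someI_ex[OF inv[unfolded invertible_def]] by (simp add: matrix_inv_def)
  then have "A *v (transpose A *v ?w) = A *v x - b"
    by (metis matrix_vector_mul_assoc matrix_vector_mul_lid)
  then show q: "A *v q = b"
    by (simp add: q_def matrix_vector_mult_diff_distrib)
  show orth: "orthogonal (x - q) (y - q)" if "A *v y = b" for y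
  proof -
    have "(x - q) \<bullet> (y - q) = ?w \<bullet> (A *v (y - q))"
      by (simp add: q_def dot_lmul_matrix)
    also have "A *v (y - q) = 0"
      using that q by (simp add: matrix_vector_mult_diff_distrib)
    finally show ?thesis by (simp add: orthogonal_def)
  qed
  let ?M = "{y. A *v y = b}"
  have "dist x q \<le> dist x y" if "A *v y = b" for y
  proof -
    have "(norm (x - y))\<^sup>2 = (norm (x - q))\<^sup>2 + (norm (y - q))\<^sup>2"
      using norm_add_Pythagorean[of "x - q" "q - y"] orth[OF that]
      by (simp add: orthogonal_def inner_diff_right norm_minus_commute)
    then show ?thesis
      by (simp add: dist_norm power2_le_imp_le)
  qed
  moreover have "convex ?M"
    by (auto simp: convex_def matrix_vector_right_distrib matrix_vector_mult_scaleR
        simp flip: scaleR_left_distrib)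
  moreover have "closed ?M"
    by (intro closed_Collect_eq matrix_vector_mult_linear_continuous_on continuous_on_const)
  \<comment> \<open>Convexity and closedness of the affine set make the minimiser unique.\<close>
  ultimately show "q = closest_point ?M x"
    using q by (intro closest_point_unique) auto
qed

text \<open>\<open>Abs_var\<close> inverts \<open>Rep_var\<close> only on labels of existing
  coordinates, hence the exclusion of diagonal \<open>P11\<close> labels.\<close>

lemma component_vec_lambda:
  assumes "\<And>i. l \<noteq> P11 i (Some i)"
  shows "component (\<chi> v. f (Rep_var v)) l = f l"
  using assms by (simp add: component_def Abs_var_inverse)

text \<open>
  With the other probabilities set to zero, the departure probabilities solve the balance equations,
  each of which contains exactly one of them, with nonzero coefficient; the slack variables then solve the normalisation equations.
\<close>

lemma surj_A_mat:
  fixes S :: "'n::finite cluster_data"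
  assumes "admissible S t"
  shows "surj ((*v) (A_mat S t))"
proof -
  have N1: "N1 S t i \<noteq> 0" and N2: "N2 S t j \<noteq> 0" and N: "N_eff S t \<noteq> 0" for i j
    using assms add_nonneg_pos[of "dN20 S t" "N2 S t None"]
    by (auto simp: admissible_def N_eff_def order.strict_implies_not_eq[THEN not_sym])
  have "\<exists>x. A_mat S t *v x = c" for c
  proof -
    \<comment> \<open>The minus signs arise because departures enter the balance equations as
      outflow, with coefficients \<open>- N1\<close>, \<open>- N_eff\<close> and
      \<open>- N2\<close>.\<close>
    define d1 where "d1 i = - (c $ Bal_active i) / N1 S t i" for i
    define d2 where "d2 j = (case j of None \<Rightarrow> - (c $ Bal_reserve) / N_eff S t
        | Some i \<Rightarrow> - (c $ Bal_passive i) / N2 S t (Some i))" for j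
    define f where "f l = (case l of
        P11 i j \<Rightarrow> if j = None then d1 i else 0
      | P12 i \<Rightarrow> 0
      | P21 i j \<Rightarrow> if j = None then d2 i else 0
      | P_star i \<Rightarrow> c $ Norm_passive i - d2 i
      | P_sstar i \<Rightarrow> c $ Norm_active i - d1 i)" for l
    let ?x = "(\<chi> v. f (Rep_var v)) :: real ^ 'n var"
    have comp: "component ?x (P12 i) = 0" "component ?x (P21 k j) = (if j = None then d2 k else 0)"
      "component ?x (P_star k) = c $ Norm_passive k - d2 k"
      "component ?x (P_sstar i) = c $ Norm_active i - d1 i" for i j k
      by (simp_all add: component_vec_lambda f_def)
    have comp11: "component ?x (P11 i j) = (if j = None then d1 i else 0)" if "j \<noteq> Some i" for i j
      using that by (subst component_vec_lambda) (auto simp: f_def)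
    have "(\<Sum>j\<in>UNIV - {Some i}. component ?x (P11 i j))
        = (\<Sum>j\<in>UNIV - {Some i}. if j = None then d1 i else 0)" for i
      by (rule sum.cong) (auto simp: comp11)
    then have sum11: "(\<Sum>j\<in>UNIV - {Some i}. component ?x (P11 i j)) = d1 i" for i
      by simp
    \<comment> \<open>These are transfers between active clusters, not departures, so the witness
      sets them to zero.\<close>
    have in11: "(\<Sum>j\<in>UNIV - {i}. N1 S t j * component ?x (P11 j (Some i))) = 0" for i
      by (rule sum.neutral) (auto simp: comp11)
    have "eqn_lhs S t ?x e = c $ e" for e
      by (cases e) (simp_all add: comp sum11 in11 d1_def d2_def N1 N2 N)
    then have "A_mat S t *v ?x = c"
      by (simp add: vec_eq_iff A_mat_mult_nth)
    then show ?thesis ..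
  qed
  then show ?thesis by (metis surjI surj_def)
qed

theorem lemma7:
  fixes S :: "'n::finite cluster_data"
    and t :: int
    and P :: "int \<Rightarrow> real ^ 'n var"
  assumes "admissible S t"
  shows
    "(\<forall>\<delta>\<in>mat_ker (A_mat S t). A_mat S t *v (P t + \<delta>) = A_mat S t *v P t)
     \<and>
     (invertible (A_mat S t ** transpose (A_mat S t)) \<and>
      (\<forall>x. A_mat S t *v proj S t x = b_vec S t \<and>
           (\<forall>y\<in>solution_set S t. orthogonal (x - proj S t x) (y - proj S t x)) \<and>
           proj S t x = closest_point (solution_set S t) x))
     \<and>
     (admissible S (t - 1) \<longrightarrow>
      (\<forall>\<delta>\<in>mat_ker (A_mat S (t - 1)).
         A_mat S t *v \<delta> = (A_mat S t - A_mat S (t - 1)) *v \<delta> \<and>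
         norm (A_mat S t *v \<delta>)
           \<le> onorm ((*v) (A_mat S t - A_mat S (t - 1))) * norm \<delta> \<and>
         (A_mat S t = A_mat S (t - 1) \<longrightarrow> A_mat S t *v \<delta> = 0)))"
proof (intro conjI ballI allI impI)
  let ?A = "A_mat S t"
  show inv: "invertible (?A ** transpose ?A)"
    using assms by (intro invertible_mult_transpose surj_A_mat)
  show "?A *v (P t + \<delta>) = ?A *v P t" if "\<delta> \<in> mat_ker ?A" for \<delta>
    using that by (simp add: mat_ker_def matrix_vector_right_distrib)
  fix x
  show "?A *v proj S t x = b_vec S t"
    using affine_projection_solves[OF inv, where b = "b_vec S t" and x = x] by (simp add: proj_def Let_def)
  show "orthogonal (x - proj S t x) (y - proj S t x)" if "y \<in> solution_set S t" for y
    using affine_projection_orthogonal[OF inv, where b = "b_vec S t" and x = x] that by (simp add: proj_def solution_set_def Let_def)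
  show "proj S t x = closest_point (solution_set S t) x"
    using affine_projection_closest_point[OF inv, where b = "b_vec S t" and x = x] by (simp add: proj_def solution_set_def Let_def)
next
  let ?A = "A_mat S t" and ?A' = "A_mat S (t - 1)"
  fix \<delta>
  assume "\<delta> \<in> mat_ker ?A'"
  \<comment> \<open>Subtracting A(t-1)\<delta> = 0 changes nothing; the norm bound and the
    time-invariant case both follow from this identity.\<close>
  then show eq: "?A *v \<delta> = (?A - ?A') *v \<delta>"
    by (simp add: mat_ker_def matrix_vector_mult_diff_rdistrib)
  show "norm (?A *v \<delta>) \<le> onorm ((*v) (?A - ?A')) * norm \<delta>"
    unfolding eq by (rule onorm) simp
  show "?A *v \<delta> = 0" if "?A = ?A'"
    using eq that by simp
qed

end
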